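(* Suppose that $A$ is a Riesz spectrum operator on $Z$ with representation $A=\sum_{j=1}^\infty\lambda_j\langle\cdot,\varphi_j\rangle_Z\,\phi_j$ and that $A$ generates a strongly continuous semigroup $\{T^t\}_{t\ge0}$ on $Z$; let $C\in\mathcal L(Z,\mathbb R^m)$ and $E\in\mathcal L(Z,\mathbb R^d)$. Then the system $(A,C,E)$ is Koopman approximately observable in infinite time if and only if every eigenfunction $\phi_j$ that satisfies $C\phi_j=0$ also satisfies $E\phi_j=0$ (equivalently, if and only if $C\phi_j\ne0$ for every eigenfunction $\phi_j\notin\ker E$).
   Context: Setting. $Z$ is a Hilbert space (in the paper, an RKHS on the state space $\mathbb X\subseteq\mathbb R^d$ of a nonlinear system $\dot x=f(x)$, $y=h(x)$ with flow $S^t$); $A:\mathcal D(A)\to Z$ is the infinitesimal generator of a strongly continuous semigroup $\{T^t\}_{t\ge0}$ on $Z$ (in the paper, the adjoint of the Koopman semigroup $K^tg=g\circ S^t$); $C\in\mathcal L(Z,\mathbb R^m)$ and $E\in\mathcal L(Z,\mathbb R^d)$ are bounded linear operators (in the paper, $Cz=(\langle h_i,z\rangle)_i$ and $Ez=(\langle e_k,z\rangle)_k$ with $e_k(x)=x_k$). The system $(A,C,E)$ is $\dot z=Az$, $y=Cz$, $x=Ez$. As usual, eigenvalues and eigenvectors are taken in the complexification. Riesz spectrum operator. A closed, densely defined operator $A$ on $Z$ is a Riesz spectrum operator if it has simple eigenvalues $\{\lambda_j\}_{j=1}^\infty$ with at most finitely many limit points and the associated eigenvectors $\{\phi_j\}_{j=1}^\infty$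 form a Riesz basis of $Z$ (i.e., their span is dense and there are constants $0<c_1\le c_2$ with $c_1\sum_{j=1}^n|\alpha_j|^2\le\|\sum_{j=1}^n\alpha_j\phi_j\|^2\le c_2\sum_{j=1}^n|\alpha_j|^2$ for all $n$ and all scalars $\alpha_j$). Let $\{\varphi_j\}$ be the biorthogonal basis, $\langle\phi_j,\varphi_{j'}\rangle=\delta_{jj'}$; then $A=\sum_j\lambda_j\langle\cdot,\varphi_j\rangle\phi_j$ with $\mathcal D(A)=\{z\in Z:\sum_j|\lambda_j|^2|\langle z,\varphi_j\rangle|^2<\infty\}$. Koopman approximate observability in infinite time. Let $\omega_0=\inf\{\omega:\exists c>0\ \forall t\ge0,\ \|T^t\|\le ce^{\omega t}\}$. For $\lambda>\omega_0$ let $\Psi^\infty_\leftarrow:Z\to L^2(\mathbb R_+,\mathbb R^m)$, $(\Psi^\infty_\leftarrow z)(t)=e^{-\lambda t}CT^tz$. The system is Koopman approximately observable in infinite time if $\ker\Psi^\infty_\leftarrow\subseteq\ker E$ for some (and hence for all) $\lambda>\omega_0$; equivalently, $\{z\in Z:CT^tz=0\ \forall t\ge0\}\subseteq\ker E$. *)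

theory Defs
  imports "HOL-Analysis.Analysis"
begin

section \<open>The complexification of a real Hilbert space\<close>

text \<open>
  The pair \<open>(u, v)\<close> stands for \<open>u + \<i>v\<close>. The library's inner product, norm and topology on
  pairs are the underlying real ones of the complexification:
  \<open>norm (u, v) ^ 2 = norm u ^ 2 + norm v ^ 2\<close>.
\<close>

type_synonym 'a complexification = "'a \<times> 'a"

definition cscale :: "complex \<Rightarrow> 'a::real_vector complexification \<Rightarrow> 'a complexification"
    (infixr "*\<^sub>C" 75) where
  "c *\<^sub>C z = (Re c *\<^sub>R fst z - Im c *\<^sub>R snd z, Re c *\<^sub>R snd z + Im c *\<^sub>R fst z)"

text \<open>Linear in the first argument and antilinear in the second.\<close>

definition cinner :: "'a::real_inner complexification \<Rightarrow> 'a complexification \<Rightarrow> complex" where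
  "cinner z w = Complex (fst z \<bullet> fst w + snd z \<bullet> snd w) (snd z \<bullet> fst w - fst z \<bullet> snd w)"

definition complexify :: "('a \<Rightarrow> 'b) \<Rightarrow> 'a complexification \<Rightarrow> 'b complexification" where
  "complexify f = map_prod f f"

interpretation complexification: vector_space "cscale :: complex \<Rightarrow> 'a::real_vector complexification \<Rightarrow> _"
  by unfold_locales (auto simp: cscale_def algebra_simps prod_eq_iff)


section \<open>Unbounded operators and their eigenvalues\<close>

text \<open>
  An unbounded operator on \<open>Z\<close> is given by its domain \<open>D\<close> and a function \<open>A\<close> whose values
  outside \<open>D\<close> are irrelevant. The domain of its complexification is \<open>D \<times> D\<close>.
\<close>

definition linear_operator :: "'a::real_vector set \<Rightarrow> ('a \<Rightarrow> 'a) \<Rightarrow> bool" where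
  "linear_operator D A \<longleftrightarrow> subspace D \<and>
     (\<forall>x\<in>D. \<forall>y\<in>D. A (x + y) = A x + A y) \<and> (\<forall>x\<in>D. \<forall>r. A (r *\<^sub>R x) = r *\<^sub>R A x)"

definition closed_operator :: "'a::real_normed_vector set \<Rightarrow> ('a \<Rightarrow> 'a) \<Rightarrow> bool" where
  "closed_operator D A \<longleftrightarrow> closed ((\<lambda>x. (x, A x)) ` D)"

definition densely_defined :: "'a::topological_space set \<Rightarrow> bool" where
  "densely_defined D \<longleftrightarrow> closure D = UNIV"

definition eigenvector ::
    "'a::real_vector set \<Rightarrow> ('a \<Rightarrow> 'a) \<Rightarrow> complex \<Rightarrow> 'a complexification \<Rightarrow> bool" where
  "eigenvector D A \<mu> v \<longleftrightarrow> v \<in> D \<times> D \<and> v \<noteq> 0 \<and> complexify A v = \<mu> *\<^sub>C v"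

definition eigenvalue :: "'a::real_vector set \<Rightarrow> ('a \<Rightarrow> 'a) \<Rightarrow> complex \<Rightarrow> bool" where
  "eigenvalue D A \<mu> \<longleftrightarrow> (\<exists>v. eigenvector D A \<mu> v)"

text \<open>The kernel of \<open>(A - \<mu>)^n\<close> on its natural domain, in the complexification.\<close>

primrec kernel_power ::
    "'a::real_vector set \<Rightarrow> ('a \<Rightarrow> 'a) \<Rightarrow> complex \<Rightarrow> nat \<Rightarrow> 'a complexification set" where
  "kernel_power D A \<mu> 0 = {0}"
| "kernel_power D A \<mu> (Suc n) = {v \<in> D \<times> D. complexify A v - \<mu> *\<^sub>C v \<in> kernel_power D A \<mu> n}"

text \<open>Algebraic multiplicity one.\<close>

definition simple_eigenvalue :: "'a::real_vector set \<Rightarrow> ('a \<Rightarrow> 'a) \<Rightarrow> complex \<Rightarrow> bool" where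
  "simple_eigenvalue D A \<mu> \<longleftrightarrow>
     eigenvalue D A \<mu> \<and> complexification.dim (\<Union>n. kernel_power D A \<mu> n) = 1"


section \<open>Riesz spectrum operators\<close>

definition riesz_basis :: "(nat \<Rightarrow> 'a::real_inner complexification) \<Rightarrow> bool" where
  "riesz_basis \<phi> \<longleftrightarrow>
     closure (complexification.span (range \<phi>)) = UNIV \<and>
     (\<exists>c1 c2. 0 < c1 \<and> c1 \<le> c2 \<and>
       (\<forall>n (\<alpha> :: nat \<Rightarrow> complex).
          c1 * (\<Sum>j<n. (cmod (\<alpha> j))\<^sup>2) \<le> (norm (\<Sum>j<n. \<alpha> j *\<^sub>C \<phi> j))\<^sup>2 \<and>
          (norm (\<Sum>j<n. \<alpha> j *\<^sub>C \<phi> j))\<^sup>2 \<le> c2 * (\<Sum>j<n. (cmod (\<alpha> j))\<^sup>2)))"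

text \<open>
  The sequence \<open>\<mu>\<close> enumerates the eigenvalues of \<open>A\<close> without repetition, and \<open>\<phi> j\<close> is an
  eigenvector for \<open>\<mu> j\<close>.
\<close>

definition riesz_spectrum_operator ::
    "'a::real_inner set \<Rightarrow> ('a \<Rightarrow> 'a) \<Rightarrow> (nat \<Rightarrow> complex) \<Rightarrow> (nat \<Rightarrow> 'a complexification) \<Rightarrow> bool" where
  "riesz_spectrum_operator D A \<mu> \<phi> \<longleftrightarrow>
     linear_operator D A \<and> closed_operator D A \<and> densely_defined D \<and>
     {z. eigenvalue D A z} = range \<mu> \<and> inj \<mu> \<and> (\<forall>j. simple_eigenvalue D A (\<mu> j)) \<and>
     finite {z. z islimpt range \<mu>} \<and>
     (\<forall>j. eigenvector D A (\<mu> j) (\<phi> j)) \<and> riesz_basis \<phi>"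

definition biorthogonal ::
    "(nat \<Rightarrow> 'a::real_inner complexification) \<Rightarrow> (nat \<Rightarrow> 'a complexification) \<Rightarrow> bool" where
  "biorthogonal \<phi> \<psi> \<longleftrightarrow> (\<forall>i j. cinner (\<phi> i) (\<psi> j) = (if i = j then 1 else 0))"

text \<open>\<open>A = (\<Sum>j. \<mu> j \<langle>\<cdot>, \<psi> j\<rangle> \<phi> j)\<close> with its maximal domain.\<close>

definition spectral_representation ::
    "'a::real_inner set \<Rightarrow> ('a \<Rightarrow> 'a) \<Rightarrow> (nat \<Rightarrow> complex) \<Rightarrow>
     (nat \<Rightarrow> 'a complexification) \<Rightarrow> (nat \<Rightarrow> 'a complexification) \<Rightarrow> bool" where
  "spectral_representation D A \<mu> \<phi> \<psi> \<longleftrightarrow>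
     D \<times> D = {z. summable (\<lambda>j. (cmod (\<mu> j))\<^sup>2 * (cmod (cinner z (\<psi> j)))\<^sup>2)} \<and>
     (\<forall>z\<in>D \<times> D. (\<lambda>j. (\<mu> j * cinner z (\<psi> j)) *\<^sub>C \<phi> j) sums complexify A z)"


section \<open>Strongly continuous semigroups\<close>

text \<open>Only the values \<open>T t\<close> with \<open>t \<ge> 0\<close> matter.\<close>

definition strongly_continuous_semigroup ::
    "(real \<Rightarrow> 'a::real_normed_vector \<Rightarrow>\<^sub>L 'a) \<Rightarrow> bool" where
  "strongly_continuous_semigroup T \<longleftrightarrow>
     T 0 = id_blinfun \<and>
     (\<forall>s\<ge>0. \<forall>t\<ge>0. T (s + t) = T s o\<^sub>L T t) \<and>
     (\<forall>z. ((\<lambda>t. T t z) \<longlongrightarrow> z) (at_right 0))"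

definition generates ::
    "'a::real_normed_vector set \<Rightarrow> ('a \<Rightarrow> 'a) \<Rightarrow> (real \<Rightarrow> 'a \<Rightarrow>\<^sub>L 'a) \<Rightarrow> bool" where
  "generates D A T \<longleftrightarrow>
     strongly_continuous_semigroup T \<and>
     D = {z. \<exists>w. ((\<lambda>t. (T t z - z) /\<^sub>R t) \<longlongrightarrow> w) (at_right 0)} \<and>
     (\<forall>z\<in>D. ((\<lambda>t. (T t z - z) /\<^sub>R t) \<longlongrightarrow> A z) (at_right 0))"

text \<open>Extended real, since the set of exponential bounds may be unbounded below.\<close>

definition growth_bound :: "(real \<Rightarrow> 'a::real_normed_vector \<Rightarrow>\<^sub>L 'a) \<Rightarrow> ereal" where
  "growth_bound T = Inf (ereal ` {\<omega>. \<exists>c>0. \<forall>t\<ge>0. norm (T t) \<le> c * exp (\<omega> * t)})"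


section \<open>Koopman approximate observability in infinite time\<close>

definition observability_map ::
    "(real \<Rightarrow> 'a::real_normed_vector \<Rightarrow>\<^sub>L 'a) \<Rightarrow> ('a \<Rightarrow>\<^sub>L (real ^ 'm)) \<Rightarrow> real \<Rightarrow> 'a \<Rightarrow> real \<Rightarrow> real ^ 'm"
  where
  "observability_map T C \<kappa> z t = exp (- \<kappa> * t) *\<^sub>R C (T t z)"

text \<open>The values lie in \<open>L\<^sup>2\<close>, so being zero means vanishing almost everywhere on the half-line.\<close>

definition observability_kernel ::
    "(real \<Rightarrow> 'a::real_normed_vector \<Rightarrow>\<^sub>L 'a) \<Rightarrow> ('a \<Rightarrow>\<^sub>L (real ^ 'm)) \<Rightarrow> real \<Rightarrow> 'a set" where
  "observability_kernel T C \<kappa> =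
     {z. AE t in lebesgue_on {0..}. observability_map T C \<kappa> z t = 0}"

definition koopman_approx_observable ::
    "(real \<Rightarrow> 'a::real_normed_vector \<Rightarrow>\<^sub>L 'a) \<Rightarrow> ('a \<Rightarrow>\<^sub>L (real ^ 'm)) \<Rightarrow> ('a \<Rightarrow>\<^sub>L (real ^ 'd)) \<Rightarrow> bool"
  where
  "koopman_approx_observable T C E \<longleftrightarrow>
     (\<exists>\<kappa>::real. growth_bound T < ereal \<kappa> \<and> observability_kernel T C \<kappa> \<subseteq> {z. E z = 0})"

end

(*
  If z lies in the kernel of the observability map, then z = sum_j a_j phi_j and T^t phi_j =
  exp(mu_j t) phi_j give sum_j a_j exp(mu_j t) C phi_j = 0 for all t >= 0. Bessel-type inequalities
  make (a_j) and the components of (C phi_j) square summable, so this exponential series converges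
  absolutely. Its Laplace transform is an absolutely convergent series of simple fractions with
  poles mu_j, and because the mu_j have only finitely many limit points, all its coefficients
  a_j C phi_j vanish. Hence a_j = 0 or C phi_j = 0, and E z = sum_j a_j E phi_j = 0.
  Conversely, C phi_j = 0 puts the real and imaginary parts of phi_j into the kernel.
*)
theory Submission
  imports Defs "HOL-Complex_Analysis.Complex_Analysis"
begin

text \<open>Beyond the semigroup law, the hypotheses control \<open>T\<close> only at time 0, by
  one-sided limits. An exponential bound on \<open>norm (T t)\<close> has to be extracted by uniform
  boundedness. It serves three purposes: some real number exceeds the growth bound; the real parts
  of the eigenvalues are bounded above, so the Laplace transform has a half-plane to live on; and
  the telescoping that produces the factors exp(mu_j t) stays stable. Norm convergence of the
  eigenvector expansion does not justify working term by term with the transform or continuing it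
  beyond that half-plane; absolute summability does. It comes from pairing two square summable
  sequences: the coordinates of z, by the lower Riesz bound, and the values of a bounded functional
  on the basis, by the upper one. The delicate point at the end is an exponent that is itself a
  limit of other exponents: the transform need not have an isolated singularity there, so no residue
  can be read off directly.\<close>

section \<open>Strongly continuous semigroups\<close>

text \<open>Banach-Steinhaus by Baire's theorem: the closed sets \<open>F N\<close> cover a complete
  space, so one of them contains a ball, and differences of points of that ball control every
  \<open>T k\<close> in all directions.\<close>

lemma uniform_boundedness:
  fixes T :: "nat \<Rightarrow> 'a::{real_normed_vector,complete_space} \<Rightarrow>\<^sub>L 'b::real_normed_vector"
  assumes "\<And>x. Bseq (\<lambda>n. T n x)"
  obtains M where "\<And>n. norm (T n) \<le> M"
proof -
  define F where "F N = {x. \<forall>k. norm (T k x) \<le> real N}" for N :: nat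
  have F_eq: "F N = (\<Inter>k. {x. norm (T k x) \<le> real N})" for N
    by (auto simp: F_def)
  have cl: "closed (F N)" for N
    unfolding F_eq by (intro closed_INT ballI closed_Collect_le continuous_intros)
  have "\<exists>N. x \<in> F N" for x
  proof -
    obtain K where K: "\<And>n. norm (T n x) \<le> K"
      using assms[of x] by (auto simp: Bseq_def)
    obtain N :: nat where "K \<le> real N"
      using real_arch_simple by blast
    then have "norm (T n x) \<le> real N" for n
      using K[of n] by linarith
    then show ?thesis
      unfolding F_def by blast
  qed
  then have un: "\<Union> (range F) = UNIV"
    by auto
  have "\<exists>N. interior (F N) \<noteq> {}"
  proof (rule ccontr)
    assume "\<nexists>N. interior (F N) \<noteq> {}"
    then have "Met_TC.mtopology interior_of \<Union> (range F) = {}"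
      by (intro Met_TC.metric_Baire_category_alt)
         (auto simp: cl Met_TC.mcomplete_def Cauchy_convergent_iff convergent_def)
    then show False
      by (simp add: un)
  qed
  then obtain N x where "x \<in> interior (F N)"
    by blast
  then obtain r where r: "r > 0" "ball x r \<subseteq> F N"
    by (auto simp: mem_interior)
  have "norm (T k) \<le> 4 * real N / r" for k
  proof (rule norm_blinfun_bound)
    fix y :: 'a
    show "norm (T k y) \<le> 4 * real N / r * norm y"
    proof (cases "y = 0")
      case False
      \<comment> \<open>This gives \<open>c *\<^sub>R y\<close> length \<open>r / 2\<close>, so
        \<open>x + c *\<^sub>R y\<close> stays in the ball; dividing the bound
        \<open>2 * real N\<close> by \<open>c\<close> yields the constant
        \<open>4 * real N / r\<close>.\<close>
      define c where "c = r / (2 * norm y)"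
      have c: "c > 0"
        using False r by (simp add: c_def)
      have "dist x (x + c *\<^sub>R y) < r"
        using False r by (simp add: dist_norm c_def)
      then have "x + c *\<^sub>R y \<in> F N" "x \<in> F N"
        using r by auto
      then have "norm (T k (x + c *\<^sub>R y)) \<le> real N" "norm (T k x) \<le> real N"
        by (auto simp: F_def)
      moreover have "T k (c *\<^sub>R y) = T k (x + c *\<^sub>R y) - T k x"
        by (simp add: blinfun.add_right)
      ultimately have "norm (T k (c *\<^sub>R y)) \<le> 2 * real N"
        using norm_triangle_ineq4[of "T k (x + c *\<^sub>R y)" "T k x"] by simp
      then have "c * norm (T k y) \<le> 2 * real N"
        using c by (simp add: blinfun.scaleR_right)
      then show ?thesis
        using c False r by (simp add: c_def field_simps)
    qed (simp add: blinfun.zero_right)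
  qed (use r in auto)
  then show thesis
    by (rule that)
qed

lemma semigroup_at_0:
  assumes "strongly_continuous_semigroup T"
  shows "T 0 z = z"
  using assms by (simp add: strongly_continuous_semigroup_def)

lemma semigroup_add:
  assumes "strongly_continuous_semigroup T" "s \<ge> 0" "t \<ge> 0"
  shows "T (s + t) z = T s (T t z)"
  using assms by (simp add: strongly_continuous_semigroup_def)

text \<open>Otherwise some times tend to 0 with operator norms tending to infinity, although
  \<open>T\<close> applied to any fixed vector converges along them; uniform boundedness forbids
  this.\<close>

lemma semigroup_bounded_near_0:
  fixes T :: "real \<Rightarrow> 'a::{real_normed_vector,complete_space} \<Rightarrow>\<^sub>L 'a"
  assumes T: "strongly_continuous_semigroup T"
  obtains \<delta> M where "\<delta> > 0" "\<And>t. 0 \<le> t \<Longrightarrow> t \<le> \<delta> \<Longrightarrow> norm (T t) \<le> M"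
proof -
  have "\<exists>\<delta>>0. \<exists>M. \<forall>t. 0 \<le> t \<longrightarrow> t \<le> \<delta> \<longrightarrow> norm (T t) \<le> M"
  proof (rule ccontr)
    assume neg: "\<not> ?thesis"
    have "\<exists>t. 0 \<le> t \<and> t \<le> inverse (real (Suc n)) \<and> norm (T t) > real n" for n
    proof -
      have "inverse (real (Suc n)) > 0"
        by simp
      with neg show ?thesis
        by (meson not_le)
    qed
    then obtain t where t: "\<And>n. 0 \<le> t n" "\<And>n. t n \<le> inverse (real (Suc n))"
        "\<And>n. norm (T (t n)) > real n"
      by metis
    have t_lim: "t \<longlonglongrightarrow> 0"
      by (rule tendsto_sandwich[OF _ _ tendsto_const LIMSEQ_inverse_real_of_nat])
         (use t in auto)
    have "(\<lambda>n. T (t n) z) \<longlonglongrightarrow> z" for z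
    proof (rule tendstoI)
      fix e :: real assume e: "e > 0"
      have "((\<lambda>t. T t z) \<longlongrightarrow> z) (at_right 0)"
        using T by (simp add: strongly_continuous_semigroup_def)
      then have "eventually (\<lambda>t. dist (T t z) z < e) (at_right 0)"
        using e by (rule tendstoD)
      then obtain b where b: "b > 0" "\<And>s. s > 0 \<Longrightarrow> s < b \<Longrightarrow> dist (T s z) z < e"
        by (auto simp: eventually_at_right_field)
      have "eventually (\<lambda>n. t n < b) sequentially"
        using t_lim b(1) by (rule order_tendstoD)
      then show "eventually (\<lambda>n. dist (T (t n) z) z < e) sequentially"
      proof eventually_elim
        case (elim n)
        show ?case
        \<comment> \<open>The limit along \<open>at_right 0\<close> says nothing about time 0
          itself, which the sequence may hit.\<close>
        proof (cases "t n = 0")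
          case True
          with e show ?thesis
            by (simp add: semigroup_at_0[OF T])
        next
          case False
          with t(1)[of n] elim show ?thesis
            by (intro b) auto
        qed
      qed
    qed
    then have "Bseq (\<lambda>n. T (t n) z)" for z
      by (meson convergentI convergent_imp_Bseq)
    then obtain M where M: "\<And>n. norm (T (t n)) \<le> M"
      by (rule uniform_boundedness) blast
    obtain n :: nat where "M \<le> real n"
      using real_arch_simple by blast
    with M[of n] t(3)[of n] show False
      by linarith
  qed
  then show thesis
    using that by blast
qed

text \<open>For \<open>t = n * \<delta> + r\<close> with \<open>r \<le> \<delta>\<close>, the
  semigroup law splits \<open>T t\<close> into \<open>n\<close> factors \<open>T \<delta>\<close>
  and one \<open>T r\<close>, each of norm at most \<open>c\<close>.\<close>

lemma semigroup_exponential_bound: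
  fixes T :: "real \<Rightarrow> 'a::{real_normed_vector,complete_space} \<Rightarrow>\<^sub>L 'a"
  assumes T: "strongly_continuous_semigroup T"
  obtains c \<omega> where "c > 0" "\<omega> \<ge> 0" "\<And>t. t \<ge> 0 \<Longrightarrow> norm (T t) \<le> c * exp (\<omega> * t)"
proof -
  obtain \<delta> M where \<delta>: "\<delta> > 0" and M: "\<And>t. 0 \<le> t \<Longrightarrow> t \<le> \<delta> \<Longrightarrow> norm (T t) \<le> M"
    using semigroup_bounded_near_0[OF T] by blast
  \<comment> \<open>Having \<open>c\<close> at least 1 makes \<open>ln c\<close> nonnegative, so
    \<open>\<omega> \<ge> 0\<close> and \<open>n\<close> may be replaced by the larger
    \<open>t / \<delta>\<close> in the exponent.\<close>
  define c where "c = max M 1"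
  have c: "c \<ge> 1" "\<And>t. 0 \<le> t \<Longrightarrow> t \<le> \<delta> \<Longrightarrow> norm (T t) \<le> c"
    using M by (force simp: c_def)+
  have steps: "norm (T (real n * \<delta> + r)) \<le> c ^ Suc n" if "0 \<le> r" "r \<le> \<delta>" for n r
  proof (induction n)
    case 0
    then show ?case
      using c that by simp
  next
    case (Suc n)
    have "T (real (Suc n) * \<delta> + r) = T (\<delta> + (real n * \<delta> + r))"
      by (simp add: algebra_simps)
    also have "\<dots> = T \<delta> o\<^sub>L T (real n * \<delta> + r)"
      using T \<delta> that by (simp add: strongly_continuous_semigroup_def)
    also have "norm \<dots> \<le> norm (T \<delta>) * norm (T (real n * \<delta> + r))"
      by (rule norm_blinfun_compose)
    also have "\<dots> \<le> c * c ^ Suc n"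
      using c \<delta> Suc by (intro mult_mono) auto
    finally show ?case
      by simp
  qed
  have "norm (T t) \<le> c * exp (ln c / \<delta> * t)" if "t \<ge> 0" for t
  proof -
    define n where "n = nat \<lfloor>t / \<delta>\<rfloor>"
    have n: "real n \<le> t / \<delta>" "t / \<delta> < real n + 1"
      using that \<delta> by (auto simp: n_def of_nat_nat)
    have "norm (T (real n * \<delta> + (t - real n * \<delta>))) \<le> c ^ Suc n"
      using n \<delta> by (intro steps) (auto simp: field_simps)
    also have "c ^ Suc n = c * exp (real n * ln c)"
      using c by (simp add: exp_of_nat_mult)
    also have "\<dots> \<le> c * exp (ln c / \<delta> * t)"
      using n c mult_right_mono[OF n(1), of "ln c"] by (simp add: mult.commute)
    finally show ?thesis
      by simp
  qed
  moreover have "c > 0" "ln c / \<delta> \<ge> 0"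
    using c \<delta> by auto
  ultimately show thesis
    using that by blast
qed

text \<open>Provides the witness \<open>\<kappa>\<close> that the definition of observability asks
  for.\<close>

lemma growth_bound_less_PInf:
  fixes T :: "real \<Rightarrow> 'a::{real_normed_vector,complete_space} \<Rightarrow>\<^sub>L 'a"
  assumes "strongly_continuous_semigroup T"
  obtains \<kappa> :: real where "growth_bound T < ereal \<kappa>"
proof -
  obtain c \<omega> where "c > 0" "\<And>t. t \<ge> 0 \<Longrightarrow> norm (T t) \<le> c * exp (\<omega> * t)"
    using semigroup_exponential_bound[OF assms] by blast
  then have "growth_bound T \<le> ereal \<omega>"
    unfolding growth_bound_def by (intro Inf_lower) auto
  also have "ereal \<omega> < ereal (\<omega> + 1)"
    by simp
  finally show thesis
    by (rule that)
qed

text \<open>The weight never vanishes, so \<open>\<kappa>\<close> drops out. Passing from almost all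
  to all times uses right continuity at \<open>t\<close>, which is continuity at 0 transported by
  \<open>T t\<close>.\<close>

lemma observability_kernel_iff:
  fixes T :: "real \<Rightarrow> 'a::real_normed_vector \<Rightarrow>\<^sub>L 'a"
  assumes T: "strongly_continuous_semigroup T"
  shows "z \<in> observability_kernel T C \<kappa> \<longleftrightarrow> (\<forall>t\<ge>0. C (T t z) = 0)"
proof
  assume "\<forall>t\<ge>0. C (T t z) = 0"
  then show "z \<in> observability_kernel T C \<kappa>"
    by (auto simp: observability_kernel_def observability_map_def intro!: AE_I2)
next
  assume "z \<in> observability_kernel T C \<kappa>"
  then have "AE t in lebesgue_on {0..}. C (T t z) = 0"
    by (simp add: observability_kernel_def observability_map_def)
  then have ae: "AE t in lebesgue. t \<ge> 0 \<longrightarrow> C (T t z) = 0"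
    by (subst (asm) AE_restrict_space_iff) auto
  show "\<forall>t\<ge>0. C (T t z) = 0"
  proof (intro allI impI)
    fix t :: real assume t: "t \<ge> 0"
    have "((\<lambda>h. T h z) \<longlongrightarrow> z) (at_right 0)"
      using T by (simp add: strongly_continuous_semigroup_def)
    then have lim: "((\<lambda>h. C (T t (T h z))) \<longlongrightarrow> C (T t z)) (at_right 0)"
      by (intro tendsto_intros)
    \<comment> \<open>Without such an \<open>h\<close> the whole interval from \<open>t\<close> to
      \<open>t + e\<close> would lie in the exceptional null set.\<close>
    have "\<exists>h. 0 < h \<and> h < e \<and> C (T t (T h z)) = 0" if "e > 0" for e
    proof (rule ccontr)
      assume no: "\<nexists>h. 0 < h \<and> h < e \<and> C (T t (T h z)) = 0"
      have "AE s in lebesgue. s \<notin> {t<..<t+e}"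
        using ae
      proof eventually_elim
        case (elim s)
        show ?case
        proof
          assume "s \<in> {t<..<t+e}"
          with elim t no semigroup_add[OF T t, of "s - t" z] show False
            by (auto dest: spec[of _ "s - t"])
        qed
      qed
      then have "{t<..<t+e} \<in> null_sets lebesgue"
        by (subst AE_iff_null_sets) auto
      then show False
        using that by (simp add: null_sets_def)
    qed
    then have "frequently (\<lambda>h. C (T t (T h z)) = 0) (at_right 0)"
      by (auto simp: frequently_def eventually_at_right_field)
    show "C (T t z) = 0"
    proof (rule ccontr)
      assume "C (T t z) \<noteq> 0"
      with lim have "eventually (\<lambda>h. C (T t (T h z)) \<noteq> 0) (at_right 0)"
        by (rule tendsto_imp_eventually_ne)
      with \<open>frequently _ _\<close> show False
        by (simp add: frequently_def)
    qed
  qed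
qed

section \<open>Uniqueness of exponential series\<close>

text \<open>No integral is formed. The series of antiderivatives \<open>f j\<close> of the damped
  terms \<open>d j\<close> has derivative 0, hence a constant sum on the half-line; the sum also
  decays at infinity, so it is 0. At time 0 its terms are the simple fractions up to sign.\<close>

lemma laplace_transform_sums_zero:
  fixes b \<mu> :: "nat \<Rightarrow> complex"
  assumes b: "summable (\<lambda>j. norm (b j))"
    and \<omega>: "\<And>j. Re (\<mu> j) \<le> \<omega>" and s: "Re s > \<omega>"
    and zero: "\<And>t. t \<ge> 0 \<Longrightarrow> (\<lambda>j. b j * exp (\<mu> j * of_real t)) sums 0"
  shows "(\<lambda>j. b j / (s - \<mu> j)) sums 0"
proof -
  define a where "a = Re s - \<omega>"
  have a: "a > 0"
    using s by (simp add: a_def)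
  have ne: "s - \<mu> j \<noteq> 0" and dist_ge: "norm (s - \<mu> j) \<ge> a" for j
  proof -
    have "a \<le> Re (s - \<mu> j)"
      using \<omega>[of j] by (simp add: a_def)
    also have "\<dots> \<le> norm (s - \<mu> j)"
      by (rule complex_Re_le_cmod)
    finally show "norm (s - \<mu> j) \<ge> a" .
    with a show "s - \<mu> j \<noteq> 0"
      by auto
  qed
  define f where "f = (\<lambda>j t. b j / (\<mu> j - s) * exp ((\<mu> j - s) * of_real t) :: complex)"
  define d where "d = (\<lambda>j t. b j * exp ((\<mu> j - s) * of_real t) :: complex)"
  have norm_exp: "norm (exp ((\<mu> j - s) * of_real t)) \<le> exp (- a * t)" if "t \<ge> 0" for j t
  proof -
    have "(Re (\<mu> j) - Re s) * t \<le> - a * t"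
      using \<omega>[of j] that by (intro mult_right_mono) (auto simp: a_def)
    then show ?thesis
      by simp
  qed
  have norm_f: "norm (f j t) \<le> norm (b j) / a * exp (- a * t)" if "t \<ge> 0" for j t
    unfolding f_def norm_mult norm_divide
    using norm_exp[OF that, of j] dist_ge[of j] a
    by (intro mult_mono frac_le) (auto simp: norm_minus_commute)
  have norm_d: "norm (d j t) \<le> norm (b j)" if "t \<ge> 0" for j t
  proof -
    have "norm (d j t) \<le> norm (b j) * exp (- a * t)"
      unfolding d_def norm_mult using norm_exp[OF that, of j] by (intro mult_left_mono) auto
    also have "\<dots> \<le> norm (b j) * 1"
      using a that by (intro mult_left_mono) auto
    finally show ?thesis
      by simp
  qed
  have d_sums: "(\<lambda>j. d j t) sums 0" if "t \<ge> 0" for t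
  proof -
    have "(\<lambda>j. b j * exp (\<mu> j * of_real t) * exp (- s * of_real t)) sums (0 * exp (- s * of_real t))"
      by (intro sums_mult2 zero that)
    moreover have "b j * exp (\<mu> j * of_real t) * exp (- s * of_real t) = d j t" for j
      by (simp add: d_def mult.assoc algebra_simps flip: exp_add)
    ultimately show ?thesis
      by simp
  qed
  have f_summable: "summable (\<lambda>j. f j t)" if "t \<ge> 0" for t
  proof (rule summable_comparison_test')
    show "summable (\<lambda>j. norm (b j) / a * exp (- a * t))"
      by (intro summable_mult2 summable_divide b)
  qed (rule norm_f[OF that])
  \<comment> \<open>Uniform convergence of the derivative series, with majorant
    \<open>norm (b j)\<close>, is what permits differentiating the series of the \<open>f j\<close>
    term by term.\<close>
  have unif: "uniform_limit {0..} (\<lambda>n t. \<Sum>j<n. d j t) (\<lambda>t. \<Sum>j. d j t) sequentially"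
    by (rule Weierstrass_m_test[OF _ b]) (auto intro: norm_d)
  have "\<exists>g. \<forall>t\<in>{0..}. (\<lambda>j. f j t) sums g t \<and> (g has_derivative (\<lambda>h. 0)) (at t within {0..})"
  proof (rule has_derivative_series[where f' = "\<lambda>j t h. h *\<^sub>R d j t" and x = 0])
    show "(f j has_derivative (\<lambda>h. h *\<^sub>R d j t)) (at t within {0..})" for j t
    proof -
      have "((\<lambda>t. b j / (\<mu> j - s) * exp ((\<mu> j - s) * t)) has_field_derivative
              b j / (\<mu> j - s) * ((\<mu> j - s) * exp ((\<mu> j - s) * of_real t))) (at (of_real t))"
        by (auto intro!: derivative_eq_intros)
      also have "b j / (\<mu> j - s) * ((\<mu> j - s) * exp ((\<mu> j - s) * of_real t)) = d j t"
        using ne[of j] by (simp add: d_def field_simps)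
      finally have "(f j has_vector_derivative d j t) (at t within {0..})"
        unfolding f_def by (rule has_vector_derivative_real_field)
      then show ?thesis
        by (simp add: has_vector_derivative_def)
    qed
    show "\<forall>\<^sub>F n in sequentially. \<forall>t\<in>{0..}. \<forall>h::real. norm ((\<Sum>j<n. h *\<^sub>R d j t) - 0) \<le> e * norm h"
      if "e > 0" for e
      using uniform_limitD[OF unif that]
    proof eventually_elim
      case (elim n)
      show ?case
      proof (intro ballI allI)
        fix t :: real and h :: real assume t: "t \<in> {0..}"
        then have "norm (\<Sum>j<n. d j t) \<le> e"
          using elim d_sums[of t] by (force simp: sums_iff)
        then have "norm h * norm (\<Sum>j<n. d j t) \<le> norm h * e"
          by (intro mult_left_mono) auto
        then show "norm ((\<Sum>j<n. h *\<^sub>R d j t) - 0) \<le> e * norm h"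
          by (simp add: mult.commute flip: scaleR_sum_right)
      qed
    qed
    show "(\<lambda>j. f j 0) sums (\<Sum>j. f j 0)"
      using f_summable[of 0] by (simp add: summable_sums)
  qed auto
  then obtain g where g: "\<And>t. t \<ge> 0 \<Longrightarrow> (\<lambda>j. f j t) sums g t"
      "\<And>t. t \<ge> 0 \<Longrightarrow> (g has_derivative (\<lambda>h. 0)) (at t within {0..})"
    by auto
  have "\<exists>c. \<forall>t\<in>{0..}. g t = c"
    by (rule has_derivative_zero_constant) (auto intro: g)
  then have const: "g t = g 0" if "t \<ge> 0" for t
    using that by (metis atLeast_iff order_refl)
  have bound: "norm (g 0) \<le> (\<Sum>j. norm (b j)) / a * exp (- a * t)" if "t \<ge> 0" for t
  proof -
    have S: "(\<lambda>j. norm (b j) / a * exp (- a * t)) sums ((\<Sum>j. norm (b j)) / a * exp (- a * t))"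
      by (intro sums_mult2 sums_divide summable_sums b)
    have sn: "summable (\<lambda>j. norm (f j t))"
      by (rule summable_comparison_test'[OF sums_summable[OF S]]) (use norm_f[OF that] in auto)
    have "norm (g t) \<le> (\<Sum>j. norm (f j t))"
      using summable_norm[OF sn] g(1)[OF that] by (simp add: sums_iff)
    also have "\<dots> \<le> (\<Sum>j. norm (b j)) / a * exp (- a * t)"
      using suminf_le[OF norm_f[OF that] sn sums_summable[OF S]] S by (simp add: sums_iff)
    finally show ?thesis
      by (simp add: const[OF that])
  qed
  have "((\<lambda>t. (\<Sum>j. norm (b j)) / a * exp (- a * t)) \<longlongrightarrow> (\<Sum>j. norm (b j)) / a * 0) at_top"
    using a by (intro tendsto_mult tendsto_const) real_asymp
  then have "norm (g 0) \<le> (\<Sum>j. norm (b j)) / a * 0"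
    by (rule tendsto_lowerbound) (use bound in \<open>auto intro!: eventually_at_top_linorderI[of 0]\<close>)
  then have "(\<lambda>j. f j 0) sums 0"
    using g(1)[of 0] by simp
  then have "(\<lambda>j. - f j 0) sums - 0"
    by (rule sums_minus)
  moreover have "- f j 0 = b j / (s - \<mu> j)" for j
    by (simp add: f_def minus_divide_right)
  ultimately show ?thesis
    by simp
qed

text \<open>Off the closure of the poles, a small ball keeps a positive distance from all of them at
  once, so a multiple of \<open>norm (b j)\<close> dominates the series locally.\<close>

lemma holomorphic_partial_fraction_series:
  fixes b \<mu> :: "nat \<Rightarrow> complex"
  assumes b: "summable (\<lambda>j. norm (b j))"
  obtains F where "F holomorphic_on - closure (range \<mu>)"
    "\<And>s. s \<notin> closure (range \<mu>) \<Longrightarrow> (\<lambda>j. b j / (s - \<mu> j)) sums F s"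
proof -
  let ?U = "- closure (range \<mu>)"
  have U: "s \<noteq> \<mu> j" if "s \<in> ?U" for s j
    using that closure_subset[of "range \<mu>"] by auto
  obtain F where F: "\<forall>s\<in>?U. (\<lambda>j. b j / (s - \<mu> j)) sums F s \<and> F field_differentiable at s"
  proof (rule series_differentiable_comparison_complex)
    show "open ?U"
      by auto
    show "(\<lambda>s. b j / (s - \<mu> j)) field_differentiable at s" if "s \<in> ?U" for s j
      using U[OF that] by (auto intro!: derivative_intros)
    show "\<exists>d h. 0 < d \<and> summable h \<and> range h \<subseteq> \<real>\<^sub>\<ge>\<^sub>0 \<and>
        (\<forall>\<^sub>F n in sequentially. \<forall>y\<in>ball s d \<inter> ?U. cmod (b n / (y - \<mu> n)) \<le> cmod (h n))"
      if "s \<in> ?U" for s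
    proof -
      from that obtain e where e: "e > 0" "ball s e \<subseteq> ?U"
        by (meson open_contains_ball closed_closure open_Compl)
      \<comment> \<open>On the ball of half the radius every denominator is at least
        \<open>e / 2\<close>. The majorant is complex-valued because the comparison theorem requires
        that.\<close>
      define h where "h = (\<lambda>n. of_real (norm (b n) * (2 / e)) :: complex)"
      have "norm (b n / (y - \<mu> n)) \<le> norm (h n)" if "y \<in> ball s (e / 2)" for n y
      proof -
        have "\<mu> n \<notin> ball s e"
          using e(2) U by blast
        then have "e \<le> norm (s - \<mu> n)"
          by (simp add: dist_norm)
        also have "\<dots> \<le> norm (s - y) + norm (y - \<mu> n)"
          using norm_triangle_ineq[of "s - y" "y - \<mu> n"] by simp
        finally have "e / 2 \<le> norm (y - \<mu> n)"
          using that by (simp add: dist_norm)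
        then have "norm (b n) / norm (y - \<mu> n) \<le> norm (b n) / (e / 2)"
          using e by (intro frac_le) auto
        also have "\<dots> = norm (h n)"
          using e by (simp only: h_def norm_of_real) simp
        finally show ?thesis
          by (simp add: norm_divide)
      qed
      moreover have "summable h"
        unfolding h_def by (intro summable_of_real summable_mult2 b)
      moreover have "range h \<subseteq> \<real>\<^sub>\<ge>\<^sub>0"
        using e unfolding h_def image_subset_iff nonneg_Reals_of_real_iff by auto
      ultimately show ?thesis
        using e by (intro exI[of _ "e / 2"] exI[of _ h]) auto
    qed
  qed
  show thesis
    using F by (intro that[of F]) (auto simp: holomorphic_on_def field_differentiable_at_within)
qed

text \<open>Multiply the vanishing sum by \<open>s - \<mu> k\<close> and let \<open>s\<close> tend
  to \<open>\<mu> k\<close> inside \<open>U\<close>: all other terms together stay bounded, so only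
  \<open>b k\<close> survives. Separation is demanded only where \<open>b j \<noteq> 0\<close>, so
  that poles already known to have coefficient 0 may accumulate at \<open>\<mu> k\<close>.\<close>

lemma simple_pole_coefficient_zero:
  fixes b \<mu> :: "nat \<Rightarrow> complex"
  assumes b: "summable (\<lambda>j. norm (b j))"
    and zero: "\<And>s. s \<in> U \<Longrightarrow> (\<lambda>j. b j / (s - \<mu> j)) sums 0"
    and islimpt: "\<mu> k islimpt U"
    and sep: "d > 0" "\<And>j. j \<noteq> k \<Longrightarrow> b j \<noteq> 0 \<Longrightarrow> dist (\<mu> j) (\<mu> k) \<ge> d"
  shows "b k = 0"
proof -
  define B where "B = (\<Sum>j. norm (b j))"
  have bound: "norm (b k) \<le> norm (s - \<mu> k) * (B * (2 / d))"
    if s: "s \<in> U" "s \<noteq> \<mu> k" "dist s (\<mu> k) < d / 2" for s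
  proof -
    define r where "r = (\<lambda>j. if j = k then 0 else b j / (s - \<mu> j))"
    have "(\<lambda>j. b j / (s - \<mu> j) - (if j = k then b k / (s - \<mu> k) else 0)) sums (0 - b k / (s - \<mu> k))"
      by (intro sums_diff zero s(1) sums_single)
    also have "(\<lambda>j. b j / (s - \<mu> j) - (if j = k then b k / (s - \<mu> k) else 0)) = r"
      by (auto simp: r_def)
    finally have r_sums: "r sums (- (b k / (s - \<mu> k)))"
      by simp
    have r_le: "norm (r j) \<le> norm (b j) * (2 / d)" for j
    proof (cases "j = k \<or> b j = 0")
      case False
      then have "d \<le> dist (\<mu> j) (\<mu> k)"
        using sep(2) by blast
      also have "\<dots> \<le> dist s (\<mu> j) + dist s (\<mu> k)"
        by (rule dist_triangle3)
      finally have "d / 2 \<le> norm (s - \<mu> j)"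
        using s(3) by (simp add: dist_norm)
      then have "norm (b j) / norm (s - \<mu> j) \<le> norm (b j) / (d / 2)"
        using sep(1) by (intro frac_le) auto
      with False show ?thesis
        by (simp add: r_def norm_divide)
    qed (use sep(1) in \<open>auto simp: r_def\<close>)
    have sb: "summable (\<lambda>j. norm (b j) * (2 / d))"
      by (intro summable_mult2 b)
    have sr: "summable (\<lambda>j. norm (r j))"
      by (rule summable_comparison_test'[OF sb]) (use r_le in auto)
    have "norm (b k / (s - \<mu> k)) \<le> (\<Sum>j. norm (r j))"
      using summable_norm[OF sr] r_sums by (simp add: sums_iff)
    also have "\<dots> \<le> B * (2 / d)"
      unfolding B_def using suminf_le[OF r_le sr sb] by (simp only: suminf_mult2[OF b])
    finally show ?thesis
      using s(2) by (simp add: norm_divide field_simps)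
  qed
  have "B \<ge> 0"
    unfolding B_def by (intro suminf_nonneg b) auto
  have "norm (b k) \<le> e" if "e > 0" for e
  proof -
    \<comment> \<open>The added 1 keeps the divisor positive even when \<open>B\<close> is
      0.\<close>
    define K where "K = B * (2 / d) + 1"
    have K: "K > 0"
      using \<open>B \<ge> 0\<close> sep(1) by (simp add: K_def add_nonneg_pos)
    have "min (d / 2) (e / K) > 0"
      using sep(1) that K by simp
    then obtain s where s: "s \<in> U" "s \<noteq> \<mu> k" "dist s (\<mu> k) < min (d / 2) (e / K)"
      using islimpt unfolding islimpt_approachable by blast
    have "norm (b k) \<le> norm (s - \<mu> k) * (B * (2 / d))"
      using s by (intro bound) auto
    also have "\<dots> \<le> norm (s - \<mu> k) * K"
      by (intro mult_left_mono) (auto simp: K_def)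
    also have "\<dots> \<le> e"
      using s K by (simp add: dist_norm field_simps)
    finally show ?thesis .
  qed
  then have "norm (b k) \<le> 0"
    by (rule field_le_epsilon[of _ 0, simplified])
  then show ?thesis
    by simp
qed

text \<open>
  The closure of the set of exponents is countable, so its complement is connected and the Laplace
  transform \<open>\<Sum>j. b j / (s - \<mu> j)\<close> vanishes on all of it. The coefficients at isolated exponents are
  residues, hence zero; only finitely many terms remain, whose exponents are then isolated from
  each other.
\<close>

lemma exponential_series_unique:
  fixes b \<mu> :: "nat \<Rightarrow> complex"
  assumes b: "summable (\<lambda>j. norm (b j))"
    and \<mu>: "inj \<mu>" "finite {z. z islimpt range \<mu>}" "\<And>j. Re (\<mu> j) \<le> \<omega>"
    and zero: "\<And>t. t \<ge> 0 \<Longrightarrow> (\<lambda>j. b j * exp (\<mu> j * of_real t)) sums 0"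
  shows "b k = 0"
proof -
  let ?S = "closure (range \<mu>)"
  have S_countable: "countable ?S"
    unfolding closure_def using \<mu>(2) by (auto intro: countable_finite)
  obtain F where F: "F holomorphic_on - ?S"
      "\<And>s. s \<notin> ?S \<Longrightarrow> (\<lambda>j. b j / (s - \<mu> j)) sums F s"
    using holomorphic_partial_fraction_series[OF b] by blast
  have "?S \<subseteq> {s. Re s \<le> \<omega>}"
    using \<mu>(3) by (intro closure_minimal closed_halfspace_Re_le) auto
  then have halfplane: "{s. Re s > \<omega>} \<subseteq> - ?S"
    by auto
  have "F s = 0" if "s \<notin> ?S" for s
  proof (rule analytic_continuation_open[where f = F and s = "{s. Re s > \<omega>}" and s' = "- ?S" and g = "\<lambda>_. 0"])
    have "Complex (\<omega> + 1) 0 \<in> {s. Re s > \<omega>}"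
      by simp
    then show "{s. Re s > \<omega>} \<noteq> {}"
      by blast
    have "connected (UNIV - ?S)"
      by (rule connected_open_diff_countable) (auto simp: S_countable)
    then show "connected (- ?S)"
      by (simp add: Compl_eq_Diff_UNIV)
    show "F z = 0" if "z \<in> {s. Re s > \<omega>}" for z
    proof (rule sums_unique2)
      show "(\<lambda>j. b j / (z - \<mu> j)) sums F z"
        using F(2) that halfplane by blast
      show "(\<lambda>j. b j / (z - \<mu> j)) sums 0"
        using that by (intro laplace_transform_sums_zero[OF b \<mu>(3) _ zero]) auto
    qed
  qed (use F that halfplane in \<open>auto simp: open_halfspace_Re_gt\<close>)
  with F(2) have sums0: "(\<lambda>j. b j / (s - \<mu> j)) sums 0" if "s \<in> - ?S" for s
    using that by fastforce
  \<comment> \<open>Every exponent must be approachable through points where the transform is known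
    to vanish, even an exponent at which others accumulate; a countable set cannot fill a
    ball.\<close>
  have islimpt: "z islimpt - ?S" for z
    unfolding islimpt_def
  proof (intro allI impI)
    fix V assume "z \<in> V" "open V"
    then obtain e where e: "e > 0" "ball z e \<subseteq> V"
      by (meson open_contains_ball)
    have "\<not> ball z e \<subseteq> insert z ?S"
      using uncountable_ball[OF e(1), of z] countable_subset[of "ball z e" "insert z ?S"] S_countable
      by auto
    with e show "\<exists>y\<in>- ?S. y \<in> V \<and> y \<noteq> z"
      by blast
  qed
  have isolated: "b j = 0" if j: "\<not> \<mu> j islimpt range \<mu>" for j
  proof -
    obtain d where d: "d > 0" "\<And>i. \<mu> i \<noteq> \<mu> j \<Longrightarrow> dist (\<mu> i) (\<mu> j) \<ge> d"
      using j unfolding islimpt_approachable by (auto simp: not_less)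
    show ?thesis
      by (rule simple_pole_coefficient_zero[OF b sums0 islimpt d(1)])
         (use d(2) \<mu>(1) in \<open>auto simp: inj_eq\<close>)
  qed
  \<comment> \<open>By \<open>isolated\<close>, an exponent with nonzero coefficient is one of the
    finitely many limit points, so avoiding the other limit points is enough separation.\<close>
  obtain d where d: "d > 0" "\<And>z. z islimpt range \<mu> \<Longrightarrow> z \<noteq> \<mu> k \<Longrightarrow> d \<le> dist (\<mu> k) z"
    using finite_set_avoid[OF \<mu>(2), of "\<mu> k"] by blast
  show ?thesis
  proof (rule simple_pole_coefficient_zero[OF b sums0 islimpt d(1)])
    show "d \<le> dist (\<mu> j) (\<mu> k)" if "j \<noteq> k" "b j \<noteq> 0" for j
      using d(2)[of "\<mu> j"] isolated[of j] that \<mu>(1) by (auto simp: inj_eq dist_commute)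
  qed
qed

section \<open>Riesz bases in the complexification\<close>

lemma norm_cscale: "norm (c *\<^sub>C z) = cmod c * norm z" for z :: "'a::real_inner complexification"
proof -
  obtain u v where z: "z = (u, v)"
    by (cases z)
  have "(norm (Re c *\<^sub>R u - Im c *\<^sub>R v))\<^sup>2 + (norm (Re c *\<^sub>R v + Im c *\<^sub>R u))\<^sup>2
      = (cmod c)\<^sup>2 * ((norm u)\<^sup>2 + (norm v)\<^sup>2)"
    by (simp add: cmod_power2 power2_norm_eq_inner inner_simps inner_commute[of v u] algebra_simps
        power2_eq_square[of "Re c"] power2_eq_square[of "Im c"] del: dot_square_norm)
  then show ?thesis
    by (simp add: z cscale_def norm_Pair real_sqrt_mult)
qed

lemma complexify_cscale:
  assumes "bounded_linear f"
  shows "complexify f (c *\<^sub>C z) = c *\<^sub>C complexify f z"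
  using assms
  by (cases z) (simp add: complexify_def cscale_def linear_simps)

lemma bounded_linear_complexify:
  assumes "bounded_linear f"
  shows "bounded_linear (complexify f)"
proof -
  have "complexify f = (\<lambda>z. (f (fst z), f (snd z)))"
    by (auto simp: complexify_def)
  then show ?thesis
    using assms by (auto intro!: bounded_linear_Pair bounded_linear_compose[of f]
        bounded_linear_fst bounded_linear_snd)
qed

lemma norm_complexify_le: "norm (complexify (blinfun_apply f) z) \<le> norm f * norm z"
proof -
  have "(norm (f (fst z)))\<^sup>2 + (norm (f (snd z)))\<^sup>2
      \<le> (norm f * norm (fst z))\<^sup>2 + (norm f * norm (snd z))\<^sup>2"
    by (intro add_mono power_mono norm_blinfun) auto
  also have "\<dots> = (norm f * norm z)\<^sup>2"
    by (simp add: norm_prod_def power_mult_distrib distrib_left)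
  finally have "(norm (complexify (blinfun_apply f) z))\<^sup>2 \<le> (norm f * norm z)\<^sup>2"
    by (cases z) (simp add: complexify_def norm_prod_def)
  then show ?thesis
    by (rule power2_le_imp_le) simp
qed

lemma cinner_add_left: "cinner (x + y) w = cinner x w + cinner y w"
  and cinner_diff_left: "cinner (x - y) w = cinner x w - cinner y w"
  and cinner_cscale_left: "cinner (c *\<^sub>C x) w = c * cinner x w"
  by (simp_all add: cinner_def cscale_def complex_eq_iff inner_add_left inner_diff_left algebra_simps)

lemma cinner_zero_left [simp]: "cinner 0 w = 0"
  by (simp add: cinner_def zero_complex.code)

lemma continuous_cinner [continuous_intros]:
  "continuous_on A f \<Longrightarrow> continuous_on A (\<lambda>x. cinner (f x) w)"
  unfolding cinner_def Complex_eq by (intro continuous_intros)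

context
  fixes \<phi> \<psi> :: "nat \<Rightarrow> 'a::real_inner complexification"
  assumes biorth: "biorthogonal \<phi> \<psi>"
begin

definition "expansion n z = (\<Sum>j<n. cinner z (\<psi> j) *\<^sub>C \<phi> j)"

lemma expansion_add: "expansion n (x + y) = expansion n x + expansion n y"
  by (simp add: expansion_def cinner_add_left complexification.scale_left_distrib sum.distrib)

lemma expansion_diff: "expansion n (x - y) = expansion n x - expansion n y"
  by (simp add: expansion_def cinner_diff_left complexification.scale_left_diff_distrib sum_subtractf)

lemma expansion_cscale: "expansion n (c *\<^sub>C x) = c *\<^sub>C expansion n x"
  by (simp add: expansion_def cinner_cscale_left complexification.scale_sum_right)

text \<open>Biorthogonality makes the partial sums exact at each \<open>\<phi> i\<close> once the
  index \<open>i\<close> is included, and eventual exactness is preserved by linear combinations.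
  This is the dense set from which both the Bessel inequality and the expansion are
  extended.\<close>

lemma expansion_span:
  assumes "z \<in> complexification.span (range \<phi>)"
  obtains N where "\<And>n. n \<ge> N \<Longrightarrow> expansion n z = z"
proof -
  let ?V = "{z. \<exists>N. \<forall>n\<ge>N. expansion n z = z}"
  have "complexification.span (range \<phi>) \<subseteq> ?V"
  proof (rule complexification.span_minimal)
    show "range \<phi> \<subseteq> ?V"
    proof (intro image_subsetI CollectI)
      fix i
      have "expansion n (\<phi> i) = \<phi> i" if "n \<ge> Suc i" for n
      proof -
        have "expansion n (\<phi> i) = (\<Sum>j<n. if j = i then \<phi> i else 0)"
          unfolding expansion_def using biorth
          by (intro sum.cong) (auto simp: biorthogonal_def)
        then show ?thesis
          using that by simp
      qed
      then show "\<exists>N. \<forall>n\<ge>N. expansion n (\<phi> i) = \<phi> i"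
        by blast
    qed
    show "complexification.subspace ?V"
    proof (rule complexification.subspaceI)
      show "0 \<in> ?V"
        by (simp add: expansion_def)
      show "x + y \<in> ?V" if "x \<in> ?V" "y \<in> ?V" for x y
      proof -
        from that obtain M N where "\<forall>n\<ge>M. expansion n x = x" "\<forall>n\<ge>N. expansion n y = y"
          by blast
        then have "\<forall>n\<ge>max M N. expansion n (x + y) = x + y"
          by (simp add: expansion_add)
        then show ?thesis
          by blast
      qed
      show "c *\<^sub>C x \<in> ?V" if "x \<in> ?V" for c x
        using that by (auto simp: expansion_cscale)
    qed
  qed
  with assms that show thesis
    by auto
qed

text \<open>On the span the coordinates reproduce the vector, so the lower Riesz bound applies to
  them. For fixed \<open>n\<close> the inequality is a closed condition and passes to the
  closure.\<close>

lemma riesz_bessel: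
  assumes "riesz_basis \<phi>"
  obtains K where "K \<ge> 0" "\<And>n z. (\<Sum>j<n. (cmod (cinner z (\<psi> j)))\<^sup>2) \<le> K * (norm z)\<^sup>2"
proof -
  from assms obtain c1 c2 where dense: "closure (complexification.span (range \<phi>)) = UNIV"
    and c: "0 < c1"
      "\<And>n \<alpha>. c1 * (\<Sum>j<n. (cmod (\<alpha> j))\<^sup>2) \<le> (norm (\<Sum>j<n. \<alpha> j *\<^sub>C \<phi> j))\<^sup>2"
    unfolding riesz_basis_def by blast
  have "(\<Sum>j<n. (cmod (cinner z (\<psi> j)))\<^sup>2) \<le> 1 / c1 * (norm z)\<^sup>2" for n z
  proof -
    let ?V = "{z. (\<Sum>j<n. (cmod (cinner z (\<psi> j)))\<^sup>2) \<le> 1 / c1 * (norm z)\<^sup>2}"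
    have "closure (complexification.span (range \<phi>)) \<subseteq> ?V"
    proof (rule closure_minimal)
      show "closed ?V"
        by (intro closed_Collect_le continuous_intros)
      show "complexification.span (range \<phi>) \<subseteq> ?V"
      proof
        fix z assume "z \<in> complexification.span (range \<phi>)"
        then obtain N where N: "\<And>n. n \<ge> N \<Longrightarrow> expansion n z = z"
          using expansion_span by blast
        \<comment> \<open>Lengthening the sum to \<open>max n N\<close> only increases it and makes
          the expansion exact.\<close>
        have "(\<Sum>j<n. (cmod (cinner z (\<psi> j)))\<^sup>2) \<le> (\<Sum>j<max n N. (cmod (cinner z (\<psi> j)))\<^sup>2)"
          by (intro sum_mono2) auto
        also have "c1 * \<dots> \<le> (norm (expansion (max n N) z))\<^sup>2"
          unfolding expansion_def by (rule c)
        then have "(\<Sum>j<max n N. (cmod (cinner z (\<psi> j)))\<^sup>2) \<le> 1 / c1 * (norm z)\<^sup>2"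
          using c(1) by (simp add: N field_simps)
        finally show "z \<in> ?V"
          by simp
      qed
    qed
    then show ?thesis
      using dense by auto
  qed
  then show thesis
    using c(1) by (intro that[of "1 / c1"]) auto
qed

text \<open>The Bessel inequality followed by the upper Riesz bound makes the partial-sum operators
  uniformly bounded; they converge pointwise on the dense span, hence everywhere.\<close>

lemma riesz_expansion_sums:
  assumes riesz: "riesz_basis \<phi>"
  shows "(\<lambda>j. cinner z (\<psi> j) *\<^sub>C \<phi> j) sums z"
proof -
  obtain K where K: "K \<ge> 0" "\<And>n z. (\<Sum>j<n. (cmod (cinner z (\<psi> j)))\<^sup>2) \<le> K * (norm z)\<^sup>2"
    using riesz_bessel[OF riesz] by blast
  from riesz obtain c1 c2 where dense: "closure (complexification.span (range \<phi>)) = UNIV"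
    and c: "0 < c1" "c1 \<le> c2"
      "\<And>n \<alpha>. (norm (\<Sum>j<n. \<alpha> j *\<^sub>C \<phi> j))\<^sup>2 \<le> c2 * (\<Sum>j<n. (cmod (\<alpha> j))\<^sup>2)"
    unfolding riesz_basis_def by blast
  define B where "B = sqrt (c2 * K)"
  have B: "B \<ge> 0"
    using K(1) c by (simp add: B_def)
  have bound: "norm (expansion n z) \<le> B * norm z" for n z
  proof (rule power2_le_imp_le)
    have "(norm (expansion n z))\<^sup>2 \<le> c2 * (\<Sum>j<n. (cmod (cinner z (\<psi> j)))\<^sup>2)"
      unfolding expansion_def by (rule c)
    also have "\<dots> \<le> c2 * (K * (norm z)\<^sup>2)"
      using c by (intro mult_left_mono K) auto
    also have "\<dots> = (B * norm z)\<^sup>2"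
      using K(1) c by (simp add: B_def power_mult_distrib)
    finally show "(norm (expansion n z))\<^sup>2 \<le> (B * norm z)\<^sup>2" .
  qed (use B in auto)
  have "(\<lambda>n. expansion n z) \<longlonglongrightarrow> z"
  proof (rule LIMSEQ_I)
    fix e :: real assume e: "e > 0"
    have "z \<in> closure (complexification.span (range \<phi>))"
      by (simp add: dense)
    moreover have "e / (B + 1) > 0"
      using e B by simp
    ultimately obtain y where y: "y \<in> complexification.span (range \<phi>)" "dist y z < e / (B + 1)"
      unfolding closure_approachable by blast
    obtain N where N: "\<And>n. n \<ge> N \<Longrightarrow> expansion n y = y"
      using expansion_span[OF y(1)] by blast
    have "norm (expansion n z - z) < e" if "n \<ge> N" for n
    proof -
      have "expansion n z - z = expansion n (z - y) - (z - y)"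
        using N[OF that] by (simp add: expansion_diff)
      also have "norm \<dots> \<le> norm (expansion n (z - y)) + norm (z - y)"
        by (rule norm_triangle_ineq4)
      also have "\<dots> \<le> (B + 1) * norm (z - y)"
        using bound[of n "z - y"] by (simp add: algebra_simps)
      also have "\<dots> < e"
        using y(2) B by (simp add: dist_norm norm_minus_commute field_simps)
      finally show ?thesis .
    qed
    then show "\<exists>N. \<forall>n\<ge>N. norm (expansion n z - z) < e"
      by blast
  qed
  then show ?thesis
    by (simp add: sums_def expansion_def)
qed

end

text \<open>Duality: testing \<open>L\<close> on the combination \<open>v\<close> with coefficients
  \<open>cnj (L (\<phi> j))\<close> returns the partial sum \<open>S\<close> itself, while the upper
  Riesz bound controls \<open>norm v\<close> by the square root of \<open>c2 * S\<close>. Cancelling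
  one factor \<open>S\<close> bounds it independently of \<open>n\<close>.\<close>

lemma riesz_functional_square_summable:
  assumes riesz: "riesz_basis \<phi>"
    and L: "bounded_linear L" "\<And>c v. L (c *\<^sub>C v) = c * L v"
  shows "summable (\<lambda>j. (cmod (L (\<phi> j)))\<^sup>2)"
proof -
  from riesz obtain c1 c2 where c: "0 < c1" "c1 \<le> c2"
      "\<And>n \<alpha>. (norm (\<Sum>j<n. \<alpha> j *\<^sub>C \<phi> j))\<^sup>2 \<le> c2 * (\<Sum>j<n. (cmod (\<alpha> j))\<^sup>2)"
    unfolding riesz_basis_def by blast
  interpret L: bounded_linear L by fact
  obtain K where K: "\<And>v. norm (L v) \<le> norm v * K"
    using L.bounded by blast
  have "(\<Sum>j<n. (cmod (L (\<phi> j)))\<^sup>2) \<le> K\<^sup>2 * c2" for n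
  proof -
    define S where "S = (\<Sum>j<n. (cmod (L (\<phi> j)))\<^sup>2)"
    define v where "v = (\<Sum>j<n. cnj (L (\<phi> j)) *\<^sub>C \<phi> j)"
    have S: "S \<ge> 0"
      unfolding S_def by (intro sum_nonneg) auto
    have "L v = of_real S"
      unfolding v_def S_def by (simp add: L.sum L(2) mult.commute[of "cnj _"] flip: complex_norm_square)
    then have "S\<^sup>2 = (norm (L v))\<^sup>2"
      by simp
    also have "\<dots> \<le> (norm v * K)\<^sup>2"
      by (intro power_mono K) auto
    also have "\<dots> = (norm v)\<^sup>2 * K\<^sup>2"
      by (simp add: power_mult_distrib)
    also have "\<dots> \<le> c2 * S * K\<^sup>2"
      using c(3)[where n = n and \<alpha> = "\<lambda>j. cnj (L (\<phi> j))"] by (intro mult_right_mono) (auto simp: v_def S_def)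
    finally have "S * S \<le> S * (K\<^sup>2 * c2)"
      by (simp add: power2_eq_square mult_ac)
    then have "S \<le> K\<^sup>2 * c2"
      using S c by (cases "S = 0") (auto simp: mult_le_cancel_left)
    then show ?thesis
      by (simp add: S_def)
  qed
  then show ?thesis
    by (intro summableI_nonneg_bounded) auto
qed

section \<open>Eigenvectors of the generator\<close>

lemma eigenvector_derivative_at_0:
  assumes gen: "generates D A T" and ev: "eigenvector D A \<mu> v"
  shows "((\<lambda>t. (complexify (T t) v - v) /\<^sub>R t) \<longlongrightarrow> \<mu> *\<^sub>C v) (at_right 0)"
proof -
  have "((\<lambda>t. ((T t (fst v) - fst v) /\<^sub>R t, (T t (snd v) - snd v) /\<^sub>R t))
      \<longlongrightarrow> (A (fst v), A (snd v))) (at_right 0)"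
    using gen ev by (intro tendsto_Pair) (auto simp: generates_def eigenvector_def)
  moreover have "(A (fst v), A (snd v)) = \<mu> *\<^sub>C v"
    using ev by (cases v) (simp add: eigenvector_def complexify_def)
  moreover have "(\<lambda>t. (complexify (T t) v - v) /\<^sub>R t)
      = (\<lambda>t. ((T t (fst v) - fst v) /\<^sub>R t, (T t (snd v) - snd v) /\<^sub>R t))"
    by (cases v) (simp add: complexify_def)
  ultimately show ?thesis
    by simp
qed

text \<open>
  The rescaled maps \<open>S t = exp (- \<mu> * t) T t\<close> satisfy \<open>S t v - v = (\<Sum>k<n. S (k * t / n) (S (t / n) v - v))\<close>,
  a sum of \<open>n\<close> terms of size \<open>o(1 / n)\<close>.
\<close>

lemma semigroup_eigenvector:
  fixes T :: "real \<Rightarrow> 'a::{real_inner,complete_space} \<Rightarrow>\<^sub>L 'a"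
  assumes gen: "generates D A T" and ev: "eigenvector D A \<mu> v" and t: "t \<ge> 0"
  shows "complexify (T t) v = exp (\<mu> * of_real t) *\<^sub>C v"
proof (cases "t = 0")
  case True
  have "strongly_continuous_semigroup T"
    using gen by (simp add: generates_def)
  with True show ?thesis
    by (cases v) (simp add: complexify_def semigroup_at_0 complexification.scale_one)
next
  case False
  with t have t: "t > 0"
    by simp
  have T: "strongly_continuous_semigroup T"
    using gen by (simp add: generates_def)
  define S where "S = (\<lambda>s z. exp (- \<mu> * of_real s) *\<^sub>C complexify (T s) z)"
  have S_add: "S (r + s) z = S r (S s z)" if "r \<ge> 0" "s \<ge> 0" for r s z
  proof -
    have "complexify (T (r + s)) z = complexify (T r) (complexify (T s) z)"
      by (cases z) (simp add: complexify_def semigroup_add[OF T that])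
    then show ?thesis
      by (simp add: S_def complexify_cscale blinfun.bounded_linear_right distrib_left flip: exp_add)
  qed
  have S_diff: "S r (x - y) = S r x - S r y" for r x y
    by (simp add: S_def complexification.scale_right_diff_distrib
        bounded_linear.linear[OF bounded_linear_complexify[OF blinfun.bounded_linear_right], THEN linear_diff])
  have S_0: "S 0 z = z" for z
    by (cases z) (simp add: S_def complexify_def semigroup_at_0[OF T])
  obtain c \<omega> where c: "c > 0" "\<omega> \<ge> 0" "\<And>s. s \<ge> 0 \<Longrightarrow> norm (T s) \<le> c * exp (\<omega> * s)"
    using semigroup_exponential_bound[OF T] by blast
  \<comment> \<open>A bound for all \<open>S s\<close> with \<open>s\<close> between 0 and
    \<open>t\<close>; the absolute value covers both signs of \<open>Re \<mu>\<close>, and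
    \<open>\<omega> \<ge> 0\<close> lets \<open>s\<close> be replaced by \<open>t\<close>.\<close>
  define K where "K = exp (\<bar>Re \<mu>\<bar> * t) * (c * exp (\<omega> * t))"
  have S_bound: "norm (S s z) \<le> K * norm z" if "0 \<le> s" "s \<le> t" for s z
  proof -
    have "- Re \<mu> * s \<le> \<bar>Re \<mu>\<bar> * s"
      using that by (intro mult_right_mono) auto
    also have "\<dots> \<le> \<bar>Re \<mu>\<bar> * t"
      using that by (intro mult_left_mono) auto
    finally have "norm (exp (- \<mu> * of_real s)) \<le> exp (\<bar>Re \<mu>\<bar> * t)"
      by simp
    moreover have "norm (complexify (T s) z) \<le> (c * exp (\<omega> * t)) * norm z"
    proof -
      have "norm (complexify (T s) z) \<le> norm (T s) * norm z"
        by (rule norm_complexify_le)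
      also have "norm (T s) \<le> c * exp (\<omega> * s)"
        using that by (intro c)
      also have "\<dots> \<le> c * exp (\<omega> * t)"
        using that c by (simp add: mult_left_mono)
      finally show ?thesis
        by (simp add: mult_right_mono)
    qed
    ultimately show ?thesis
      unfolding S_def norm_cscale K_def mult.assoc[of "exp _"] by (intro mult_mono) auto
  qed
  have S_deriv: "((\<lambda>s. (S s v - v) /\<^sub>R s) \<longlongrightarrow> 0) (at_right 0)"
  proof -
    let ?q = "\<lambda>s. (complexify (T s) v - v) /\<^sub>R s"
    have e0: "((\<lambda>s. exp (- \<mu> * of_real s)) \<longlongrightarrow> 1) (at_right 0)"
      by (rule tendsto_eq_intros refl | simp)+
    have "((\<lambda>w. exp (- \<mu> * w)) has_field_derivative (- \<mu>)) (at 0)"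
      by (auto intro!: derivative_eq_intros)
    then have "((\<lambda>w. (exp (- \<mu> * w) - 1) / w) \<longlongrightarrow> - \<mu>) (at 0)"
      by (simp add: has_field_derivative_iff)
    moreover have "filterlim complex_of_real (at 0) (at_right 0)"
      by (auto simp: filterlim_at eventually_at_filter intro!: tendsto_eq_intros)
    ultimately have "((\<lambda>s. (exp (- \<mu> * of_real s) - 1) / of_real s) \<longlongrightarrow> - \<mu>) (at_right 0)"
      by (rule filterlim_compose)
    then have e1: "((\<lambda>s. (exp (- \<mu> * of_real s) - 1) /\<^sub>R s) \<longlongrightarrow> - \<mu>) (at_right 0)"
      by (simp add: scaleR_conv_of_real divide_inverse mult.commute)
    have cs: "((\<lambda>s. f s *\<^sub>C g s) \<longlongrightarrow> a *\<^sub>C b) F"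
      if "(f \<longlongrightarrow> a) F" "(g \<longlongrightarrow> b) F" for f g F a and b :: "'a complexification"
      unfolding cscale_def using that by (intro tendsto_intros)
    \<comment> \<open>Product rule for difference quotients: the semigroup contributes
      \<open>\<mu> *\<^sub>C v\<close> and the scalar factor its negative.\<close>
    have "((\<lambda>s. exp (- \<mu> * of_real s) *\<^sub>C ?q s + ((exp (- \<mu> * of_real s) - 1) /\<^sub>R s) *\<^sub>C v)
        \<longlongrightarrow> 1 *\<^sub>C (\<mu> *\<^sub>C v) + (- \<mu>) *\<^sub>C v) (at_right 0)"
      by (intro tendsto_add cs e0 e1 tendsto_const eigenvector_derivative_at_0[OF gen ev])
    moreover have "exp (- \<mu> * of_real s) *\<^sub>C ?q s + ((exp (- \<mu> * of_real s) - 1) /\<^sub>R s) *\<^sub>C v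
        = (S s v - v) /\<^sub>R s" for s
      by (simp add: S_def cscale_def algebra_simps prod_eq_iff)
    ultimately show ?thesis
      by (simp add: complexification.scale_one)
  qed
  have telescope: "norm (S (real n * h) v - v) \<le> real n * (K * norm (S h v - v))"
    if "h \<ge> 0" "real n * h \<le> t" for n h
    using that
  proof (induction n)
    case 0
    then show ?case
      by (simp add: S_0)
  next
    case (Suc n)
    have le: "real n * h \<le> t" "0 \<le> real n * h"
      using Suc.prems by (auto simp: algebra_simps)
    have "S (real (Suc n) * h) v - v = S (real n * h) (S h v - v) + (S (real n * h) v - v)"
      using S_add[of "real n * h" h v] Suc.prems by (simp add: S_diff algebra_simps)
    also have "norm \<dots> \<le> norm (S (real n * h) (S h v - v)) + norm (S (real n * h) v - v)"
      by (rule norm_triangle_ineq)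
    also have "\<dots> \<le> K * norm (S h v - v) + real n * (K * norm (S h v - v))"
      using le Suc by (intro add_mono S_bound) auto
    finally show ?case
      by (simp add: algebra_simps)
  qed
  \<comment> \<open>With \<open>h = t / (n + 1)\<close> the number of steps times \<open>h\<close>
    is exactly \<open>t\<close>, leaving the difference quotient at \<open>h\<close>; the successor
    avoids division by 0.\<close>
  have "norm (S t v - v) \<le> K * t * norm ((S (t / real (Suc n)) v - v) /\<^sub>R (t / real (Suc n)))" for n
  proof -
    define h where "h = t / real (Suc n)"
    have h: "real (Suc n) * h = t" "h > 0"
      using t by (simp_all add: h_def)
    have "norm (S t v - v) \<le> real (Suc n) * (K * norm (S h v - v))"
      using telescope[of h "Suc n"] h by simp
    also have "\<dots> = K * (real (Suc n) * h) * (norm (S h v - v) / h)"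
      using h(2) by simp
    also have "\<dots> = K * t * norm ((S h v - v) /\<^sub>R h)"
      unfolding h(1) norm_scaleR using h(2) by (simp add: divide_inverse)
    finally show ?thesis
      by (simp only: h_def)
  qed
  moreover have "(\<lambda>n. K * t * norm ((S (t / real (Suc n)) v - v) /\<^sub>R (t / real (Suc n)))) \<longlonglongrightarrow> K * t * norm (0 :: 'a complexification)"
  proof -
    have "filterlim (\<lambda>n. t / real (Suc n)) (at_right 0) sequentially"
      using t by real_asymp
    then show ?thesis
      by (intro tendsto_mult tendsto_const tendsto_norm filterlim_compose[OF S_deriv])
  qed
  ultimately have "norm (S t v - v) \<le> 0"
    by (intro LIMSEQ_le_const[where X = "\<lambda>n. K * t * norm ((S (t / real (Suc n)) v - v) /\<^sub>R (t / real (Suc n)))"]) auto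
  then have "exp (- \<mu> * of_real t) *\<^sub>C complexify (T t) v = v"
    by (simp add: S_def)
  then have "exp (\<mu> * of_real t) *\<^sub>C v = (exp (\<mu> * of_real t) * exp (- \<mu> * of_real t)) *\<^sub>C complexify (T t) v"
    by (metis complexification.scale_scale)
  also have "\<dots> = complexify (T t) v"
    by (simp add: complexification.scale_one flip: exp_add)
  finally show ?thesis ..
qed

text \<open>On an eigenvector the semigroup grows exactly like \<open>exp (Re \<mu> * t)\<close>,
  which \<open>c * exp (\<omega> * t)\<close> could not dominate if \<open>Re \<mu>\<close> were
  larger than \<open>\<omega>\<close>.\<close>

lemma eigenvalue_Re_le_growth:
  fixes T :: "real \<Rightarrow> 'a::{real_inner,complete_space} \<Rightarrow>\<^sub>L 'a"
  assumes gen: "generates D A T" and ev: "eigenvector D A \<mu> v"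
    and bound: "\<And>t. t \<ge> 0 \<Longrightarrow> norm (T t) \<le> c * exp (\<omega> * t)"
  shows "Re \<mu> \<le> \<omega>"
proof (rule ccontr)
  assume "\<not> Re \<mu> \<le> \<omega>"
  then have pos: "Re \<mu> - \<omega> > 0"
    by simp
  have "exp ((Re \<mu> - \<omega>) * t) \<le> c" if "t \<ge> 0" for t
  proof -
    have "exp (Re \<mu> * t) * norm v = norm (complexify (T t) v)"
      by (simp add: semigroup_eigenvector[OF gen ev that] norm_cscale)
    also have "\<dots> \<le> norm (T t) * norm v"
      by (rule norm_complexify_le)
    also have "\<dots> \<le> c * exp (\<omega> * t) * norm v"
      by (intro mult_right_mono bound that) auto
    finally have "exp (Re \<mu> * t) \<le> c * exp (\<omega> * t)"
      using ev by (simp add: eigenvector_def)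
    then show ?thesis
      by (simp add: left_diff_distrib exp_diff divide_le_eq)
  qed
  then have "eventually (\<lambda>t. exp ((Re \<mu> - \<omega>) * t) \<le> c) at_top"
    by (auto intro: eventually_at_top_linorderI[of 0])
  moreover have "filterlim (\<lambda>t. exp ((Re \<mu> - \<omega>) * t)) at_top at_top"
    using pos by real_asymp
  then have "eventually (\<lambda>t. exp ((Re \<mu> - \<omega>) * t) > c) at_top"
    by (simp add: filterlim_at_top_dense)
  ultimately have "eventually (\<lambda>t::real. False) at_top"
    by eventually_elim simp
  then show False
    by simp
qed

lemma observable_components_vanish:
  fixes T :: "real \<Rightarrow> 'a::{real_inner,complete_space} \<Rightarrow>\<^sub>L 'a"
    and C :: "'a \<Rightarrow>\<^sub>L (real ^ 'm::finite)"
  assumes A: "riesz_spectrum_operator D A \<mu> \<phi>" and biorth: "biorthogonal \<phi> \<psi>"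
    and gen: "generates D A T"
    and zero: "\<And>t. t \<ge> 0 \<Longrightarrow> C (T t z) = 0"
  shows "cinner (z, 0) (\<psi> j) *\<^sub>C complexify C (\<phi> j) = 0"
proof -
  have riesz: "riesz_basis \<phi>" and ev: "\<And>j. eigenvector D A (\<mu> j) (\<phi> j)"
    and \<mu>: "inj \<mu>" "finite {z. z islimpt range \<mu>}"
    using A by (auto simp: riesz_spectrum_operator_def)
  have T: "strongly_continuous_semigroup T"
    using gen by (simp add: generates_def)
  obtain c \<omega> where "\<And>t. t \<ge> 0 \<Longrightarrow> norm (T t) \<le> c * exp (\<omega> * t)"
    using semigroup_exponential_bound[OF T] by blast
  then have Re_\<mu>: "Re (\<mu> j) \<le> \<omega>" for j
    using eigenvalue_Re_le_growth[OF gen ev] by blast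
  define \<alpha> where "\<alpha> j = cinner (z, 0) (\<psi> j)" for j
  obtain K where K: "\<And>n z. (\<Sum>j<n. (cmod (cinner z (\<psi> j)))\<^sup>2) \<le> K * (norm z)\<^sup>2"
    using riesz_bessel[OF biorth riesz] by blast
  have \<alpha>_summable: "summable (\<lambda>j. (cmod (\<alpha> j))\<^sup>2)"
    unfolding \<alpha>_def by (rule summableI_nonneg_bounded[OF _ K]) auto
  have component: "\<alpha> j * Complex (C (fst (\<phi> j)) $ i) (C (snd (\<phi> j)) $ i) = 0" for i j
  proof -
    \<comment> \<open>One complex coordinate of the complexified output: the uniqueness result for
      exponential series is about scalar coefficients.\<close>
    define L where "L = (\<lambda>v::'a complexification. Complex (C (fst v) $ i) (C (snd v) $ i))"
    have L_scale: "L (c *\<^sub>C v) = c * L v" for c v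
      by (simp add: L_def cscale_def complex_eq_iff blinfun.add_right blinfun.diff_right blinfun.scaleR_right)
    have L_bl: "bounded_linear L"
      unfolding L_def Complex_eq
      by (intro bounded_linear_add bounded_linear_const_mult
          bounded_linear_compose[OF bounded_linear_of_real]
          bounded_linear_compose[OF bounded_linear_vec_nth]
          bounded_linear_compose[OF blinfun.bounded_linear_right]
          bounded_linear_fst bounded_linear_snd)
    \<comment> \<open>By \<open>2 * a * b \<le> a^2 + b^2\<close> this series dominates the norms of
      the products.\<close>
    have "summable (\<lambda>j. ((cmod (\<alpha> j))\<^sup>2 + (cmod (L (\<phi> j)))\<^sup>2) / 2)"
      by (intro summable_divide summable_add \<alpha>_summable riesz_functional_square_summable riesz L_bl L_scale)
    then have summable: "summable (\<lambda>j. norm (\<alpha> j * L (\<phi> j)))"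
    proof (rule summable_comparison_test')
      show "norm (norm (\<alpha> j * L (\<phi> j))) \<le> ((cmod (\<alpha> j))\<^sup>2 + (cmod (L (\<phi> j)))\<^sup>2) / 2" for j
        using sum_squares_bound[of "cmod (\<alpha> j)" "cmod (L (\<phi> j))"] by (simp add: norm_mult)
    qed
    have "(\<lambda>j. \<alpha> j * L (\<phi> j) * exp (\<mu> j * of_real t)) sums 0" if t: "t \<ge> 0" for t
    proof -
      have "(\<lambda>j. \<alpha> j *\<^sub>C \<phi> j) sums (z, 0)"
        unfolding \<alpha>_def by (rule riesz_expansion_sums[OF biorth riesz])
      then have "(\<lambda>j. complexify (T t) (\<alpha> j *\<^sub>C \<phi> j)) sums complexify (T t) (z, 0)"
        by (rule bounded_linear.sums[OF bounded_linear_complexify[OF blinfun.bounded_linear_right]])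
      then have "(\<lambda>j. L (complexify (T t) (\<alpha> j *\<^sub>C \<phi> j))) sums L (complexify (T t) (z, 0))"
        by (rule bounded_linear.sums[OF L_bl])
      moreover have "L (complexify (T t) (z, 0)) = 0"
        using zero[OF t] by (simp add: L_def complexify_def complex_eq_iff blinfun.zero_right)
      moreover have "L (complexify (T t) (\<alpha> j *\<^sub>C \<phi> j)) = \<alpha> j * L (\<phi> j) * exp (\<mu> j * of_real t)" for j
        by (simp add: complexify_cscale blinfun.bounded_linear_right semigroup_eigenvector[OF gen ev t] L_scale)
      ultimately show ?thesis
        by simp
    qed
    then have "\<alpha> j * L (\<phi> j) = 0"
      by (rule exponential_series_unique[OF summable \<mu> Re_\<mu>])
    then show ?thesis
      by (simp add: L_def)
  qed
  show ?thesis
  proof (cases "\<alpha> j = 0")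
    case False
    then have "Complex (C (fst (\<phi> j)) $ i) (C (snd (\<phi> j)) $ i) = 0" for i
      using component[of j i] by (simp only: mult_eq_0_iff simp_thms)
    then have "C (fst (\<phi> j)) = 0" "C (snd (\<phi> j)) = 0"
      by (auto simp: vec_eq_iff complex_eq_iff)
    then have "complexify C (\<phi> j) = 0"
      by (cases "\<phi> j") (simp add: complexify_def zero_prod_def)
    then show ?thesis
      by simp
  qed (simp add: \<alpha>_def)
qed

theorem theorem3p20:
  fixes D :: "'a::{real_inner, complete_space} set"
    and A :: "'a \<Rightarrow> 'a"
    and T :: "real \<Rightarrow> 'a \<Rightarrow>\<^sub>L 'a"
    and C :: "'a \<Rightarrow>\<^sub>L (real ^ 'm::finite)"
    and E :: "'a \<Rightarrow>\<^sub>L (real ^ 'd::finite)"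
    and \<mu> :: "nat \<Rightarrow> complex"
    and \<phi> \<psi> :: "nat \<Rightarrow> 'a complexification"
  assumes "riesz_spectrum_operator D A \<mu> \<phi>"
    and "biorthogonal \<phi> \<psi>"
    and "spectral_representation D A \<mu> \<phi> \<psi>"
    and "generates D A T"
  shows "(koopman_approx_observable T C E \<longleftrightarrow>
            (\<forall>j. complexify C (\<phi> j) = 0 \<longrightarrow> complexify E (\<phi> j) = 0)) \<and>
         (koopman_approx_observable T C E \<longleftrightarrow>
            (\<forall>j. complexify E (\<phi> j) \<noteq> 0 \<longrightarrow> complexify C (\<phi> j) \<noteq> 0))"
proof -
  have riesz: "riesz_basis \<phi>" and ev: "\<And>j. eigenvector D A (\<mu> j) (\<phi> j)"
    using assms(1) by (auto simp: riesz_spectrum_operator_def)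
  have T: "strongly_continuous_semigroup T"
    using assms(4) by (simp add: generates_def)
  have zero_iff: "complexify (blinfun_apply B) v = 0 \<longleftrightarrow> B (fst v) = 0 \<and> B (snd v) = 0"
    for B :: "'a \<Rightarrow>\<^sub>L 'b::real_normed_vector" and v
    by (cases v) (simp add: complexify_def zero_prod_def)
  have "koopman_approx_observable T C E \<longleftrightarrow>
      (\<forall>j. complexify C (\<phi> j) = 0 \<longrightarrow> complexify E (\<phi> j) = 0)"
  proof
    assume "koopman_approx_observable T C E"
    then obtain \<kappa> where \<kappa>: "observability_kernel T C \<kappa> \<subseteq> {z. E z = 0}"
      by (auto simp: koopman_approx_observable_def)
    show "\<forall>j. complexify C (\<phi> j) = 0 \<longrightarrow> complexify E (\<phi> j) = 0"
    proof (intro allI impI)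
      fix j assume C0: "complexify C (\<phi> j) = 0"
      have "C (T t (fst (\<phi> j))) = 0 \<and> C (T t (snd (\<phi> j))) = 0" if "t \<ge> 0" for t
      proof -
        have "complexify C (complexify (T t) (\<phi> j)) = 0"
          using C0 by (simp add: semigroup_eigenvector[OF assms(4) ev that] complexify_cscale
              blinfun.bounded_linear_right)
        then show ?thesis
          by (cases "\<phi> j") (simp add: complexify_def zero_prod_def)
      qed
      then have "fst (\<phi> j) \<in> observability_kernel T C \<kappa>" "snd (\<phi> j) \<in> observability_kernel T C \<kappa>"
        by (auto simp: observability_kernel_iff[OF T])
      with \<kappa> show "complexify E (\<phi> j) = 0"
        by (auto simp: zero_iff)
    qed
  next
    assume CE: "\<forall>j. complexify C (\<phi> j) = 0 \<longrightarrow> complexify E (\<phi> j) = 0"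
    \<comment> \<open>Any admissible \<open>\<kappa>\<close> serves, since the kernel is the same
      for all of them.\<close>
    obtain \<kappa> :: real where \<kappa>: "growth_bound T < ereal \<kappa>"
      using growth_bound_less_PInf[OF T] by blast
    have "E z = 0" if "z \<in> observability_kernel T C \<kappa>" for z
    proof -
      have "cinner (z, 0) (\<psi> j) *\<^sub>C complexify C (\<phi> j) = 0" for j
        using that observability_kernel_iff[OF T]
        by (intro observable_components_vanish[OF assms(1,2,4)]) blast
      then have "cinner (z, 0) (\<psi> j) *\<^sub>C complexify E (\<phi> j) = 0" for j
        using CE by (auto simp: complexification.scale_eq_0_iff)
      then have "complexify E (cinner (z, 0) (\<psi> j) *\<^sub>C \<phi> j) = 0" for j
        by (simp add: complexify_cscale blinfun.bounded_linear_right)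
      moreover have "(\<lambda>j. complexify E (cinner (z, 0) (\<psi> j) *\<^sub>C \<phi> j)) sums complexify E (z, 0)"
        by (intro bounded_linear.sums[OF bounded_linear_complexify[OF blinfun.bounded_linear_right]]
            riesz_expansion_sums assms(2) riesz)
      ultimately have "complexify E (z, 0) = 0"
        by (simp add: sums_iff)
      then show ?thesis
        by (simp add: zero_iff)
    qed
    with \<kappa> show "koopman_approx_observable T C E"
      unfolding koopman_approx_observable_def by blast
  qed
  then show ?thesis
    by blast
qed

end
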